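(* Let $a>0$ be real, $d\ge2$ an integer and $m>a^d$ real. Then every monic polynomial $f$ of degree $d$ with $d$ real roots (counted with multiplicity) and $|f(ai)|=m$ satisfies $$\Delta_f\le \frac{m^{2d-2}d^d}{(2a)^{d(d-1)}}. \qquad ( * )$$ If, in addition, $m\ge 2^{d-1}a^d$, then, for such $f$, equality in $( * )$ is attained if and only if $f(x)=F(x)$ or $f(x)=(-1)^dF(-x)$, where, putting $D:=m^{2d-2}d^d/(2a)^{d(d-1)}$, $$F(x)=F_{a,B}(x):=\frac{1}{2ad}\Big((ad-Bi)(x+ai)^d+(ad+Bi)(x-ai)^d\Big),$$ $$B:=(-1)^d\, ad\,\sqrt{a^{-d}\,2^{2-d}\,d^{-d/(d-1)}\,D^{1/(d-1)}-1},$$ and the roots of $F$ are $a\tan(\gamma+k\pi/d)$, $k=0,1,\dots,d-1$, where $\gamma=\frac1d\arccos p$ if $d$ is odd and $\gamma=\frac1d\arcsin p$ if $d$ is even, with $p:=a^{d/2}2^{d/2-1}d^{d/(2d-2)}D^{-1/(2d-2)}$.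
   Context: For a monic polynomial $f(x)=\prod_{k=1}^d(x-x_k)$ with real roots, $\Delta_f=\prod_{1\le j<k\le d}(x_j-x_k)^2$ is its discriminant. Here $i=\sqrt{-1}$. *)

theory Defs
  imports "HOL-Analysis.Analysis" "HOL-Computational_Algebra.Computational_Algebra"
begin

definition root_disc :: "real list \<Rightarrow> real" where
  "root_disc xs = (\<Prod>j<length xs. \<Prod>k\<in>{j<..<length xs}. (xs ! j - xs ! k)\<^sup>2)"

text \<open>
  The discriminant of a monic real polynomial whose roots are all real. The sorted order only
  fixes one enumeration of the roots; by \<open>discr_eq\<close> below any other enumeration gives the
  same value.
\<close>

definition discr :: "real poly \<Rightarrow> real" where
  "discr f = root_disc (sorted_list_of_multiset (proots f))"

definition admissible :: "real \<Rightarrow> nat \<Rightarrow> real \<Rightarrow> real poly \<Rightarrow> bool" where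
  "admissible a d m f \<longleftrightarrow>
     lead_coeff f = 1 \<and> degree f = d \<and> size (proots f) = d \<and>
     cmod (poly (map_poly complex_of_real f) (complex_of_real a * \<i>)) = m"

definition disc_bound :: "real \<Rightarrow> nat \<Rightarrow> real \<Rightarrow> real" where
  "disc_bound a d m = m ^ (2 * d - 2) * real d ^ d / (2 * a) ^ (d * (d - 1))"

text \<open>In the next two definitions \<open>D\<close> stands for \<open>disc_bound a d m\<close>.\<close>

definition extremal_B :: "real \<Rightarrow> nat \<Rightarrow> real \<Rightarrow> real" where
  "extremal_B a d D =
     (-1) ^ d * a * real d *
       sqrt (a powr (- real d) * 2 powr (2 - real d) * real d powr (- real d / (real d - 1))
             * D powr (1 / (real d - 1)) - 1)"

definition extremal_p :: "real \<Rightarrow> nat \<Rightarrow> real \<Rightarrow> real" where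
  "extremal_p a d D =
     a powr (real d / 2) * 2 powr (real d / 2 - 1) * real d powr (real d / (2 * real d - 2))
       * D powr (- 1 / (2 * real d - 2))"

definition extremal_angle :: "nat \<Rightarrow> real \<Rightarrow> real" where
  "extremal_angle d p = (if odd d then arccos p else arcsin p) / real d"

definition extremal_poly :: "real \<Rightarrow> nat \<Rightarrow> real \<Rightarrow> complex poly" where
  "extremal_poly a d B =
     smult (1 / complex_of_real (2 * a * real d))
       (smult (complex_of_real (a * real d) - complex_of_real B * \<i>)
          ([:complex_of_real a * \<i>, 1:] ^ d)
        + smult (complex_of_real (a * real d) + complex_of_real B * \<i>)
          ([:- (complex_of_real a * \<i>), 1:] ^ d))"

lemma root_disc_Nil: "root_disc [] = 1"
  by (simp add: root_disc_def)

lemma root_disc_Cons: "root_disc (x # xs) = (\<Prod>y\<leftarrow>xs. (x - y)\<^sup>2) * root_disc xs"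
proof -
  have shift: "{Suc j<..<Suc n} = Suc ` {j<..<n}" for j n
    by (auto simp: image_iff Suc_less_eq2)
  have zero: "{0<..<Suc n} = Suc ` {..<n}" for n
    by (auto simp: image_iff gr0_conv_Suc)
  have "root_disc (x # xs) =
      (\<Prod>k\<in>{0<..<Suc (length xs)}. (x - (x # xs) ! k)\<^sup>2) *
      (\<Prod>j<length xs. \<Prod>k\<in>{Suc j<..<Suc (length xs)}. (xs ! j - (x # xs) ! k)\<^sup>2)"
    by (simp add: root_disc_def prod.lessThan_Suc_shift del: prod.lessThan_Suc)
  also have "\<dots> = (\<Prod>k<length xs. (x - xs ! k)\<^sup>2) * root_disc xs"
    unfolding shift zero by (subst (1 2) prod.reindex) (auto simp: root_disc_def)
  also have "(\<Prod>k<length xs. (x - xs ! k)\<^sup>2) = (\<Prod>y\<leftarrow>xs. (x - y)\<^sup>2)"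
    by (simp add: prod.list_conv_set_nth lessThan_atLeast0)
  finally show ?thesis .
qed

lemma root_disc_remove1:
  "x \<in> set xs \<Longrightarrow>
     root_disc xs = (\<Prod>y\<leftarrow>remove1 x xs. (x - y)\<^sup>2) * root_disc (remove1 x xs)"
proof (induction xs)
  case (Cons z zs)
  show ?case
  proof (cases "x = z")
    case True
    then show ?thesis by (simp add: root_disc_Cons)
  next
    case False
    with Cons.prems have x: "x \<in> set zs" by simp
    then have "(\<Prod>y\<leftarrow>zs. (z - y)\<^sup>2) = (z - x)\<^sup>2 * (\<Prod>y\<leftarrow>remove1 x zs. (z - y)\<^sup>2)"
      by (induction zs) auto
    with False show ?thesis
      by (simp add: root_disc_Cons Cons.IH[OF x] power2_commute[of z x])
  qed
qed simp

lemma root_disc_cong: "mset xs = mset ys \<Longrightarrow> root_disc xs = root_disc ys"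
proof (induction xs arbitrary: ys)
  case (Cons x xs)
  have x: "x \<in> set ys" using mset_eq_setD[OF Cons.prems] by auto
  have eq: "mset xs = mset (remove1 x ys)" by (simp flip: Cons.prems)
  have "(\<Prod>y\<leftarrow>xs. (x - y)\<^sup>2) = (\<Prod>y\<leftarrow>remove1 x ys. (x - y)\<^sup>2)"
    by (metis eq mset_map prod_mset_prod_list)
  with Cons.IH[OF eq] show ?case
    by (simp add: root_disc_Cons root_disc_remove1[OF x])
qed simp

lemma discr_eq: "discr (\<Prod>x\<leftarrow>xs. [:-x, 1:]) = root_disc xs"
proof -
  have "proots (\<Prod>x\<leftarrow>xs. [:-x, 1:]) = mset xs"
    by (induction xs) (simp_all add: proots_mult prod_list_zero_iff image_iff del: mult_pCons_left)
  then show ?thesis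
    by (auto simp: discr_def intro: root_disc_cong)
qed

end

(*
  The Cayley transform w = (x - ai) / (x + ai) sends the real roots x_j to points w_j of the unit
  circle with |w_j - w_k| = 2a |x_j - x_k| / (|x_j + ai| |x_k + ai|). As the product of the |x_j + ai|
  is m, the inequality is equivalent to Fekete's bound: the product of |w_j - w_k|^2 over all pairs
  j < k is at most d^d for points of the unit circle. At a maximal configuration the logarithmic
  derivative in each argument vanishes, so P(X) = prod_j (X - w_j) makes X P'' - (d-1) P' vanish at
  all w_j; being of degree less than d, this polynomial is 0, and hence P = X^d - c. In the equality
  case therefore f = ((x - ai)^d - c (x + ai)^d) / (1 - c) with |c| = 1, and the condition
  |f(ai)| = m prescribes |1 - c|, which determines c up to complex conjugation.
*)
theory Submission
  imports Defs
begin

section \<open>Fekete's inequality on the unit circle\<close>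

text \<open>Over ordered pairs, so this is the square of the modulus of the Vandermonde product.\<close>

definition pair_dist :: "'i set \<Rightarrow> ('i \<Rightarrow> complex) \<Rightarrow> real" where
  "pair_dist I w = (\<Prod>j\<in>I. \<Prod>k\<in>I - {j}. cmod (w j - w k))"

text \<open>A pair containing \<open>j\<close> occurs in both orders, hence the square. This
  isolates the dependence on the single point \<open>w j\<close>, as needed for moving one point at
  a time.\<close>

lemma pair_dist_remove:
  assumes "finite I" "j \<in> I"
  shows "pair_dist I w = (\<Prod>k\<in>I - {j}. cmod (w j - w k))\<^sup>2 * pair_dist (I - {j}) w"
proof -
  have "(\<Prod>k\<in>I - {i}. cmod (w i - w k)) =
      cmod (w j - w i) * (\<Prod>k\<in>I - {j} - {i}. cmod (w i - w k))" if "i \<in> I - {j}" for i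
  proof -
    have "I - {i} = insert j (I - {j} - {i})"
      using that assms by auto
    then show ?thesis
      using assms by (simp add: norm_minus_commute)
  qed
  then have "(\<Prod>i\<in>I - {j}. \<Prod>k\<in>I - {i}. cmod (w i - w k)) =
      (\<Prod>i\<in>I - {j}. cmod (w j - w i)) * pair_dist (I - {j}) w"
    by (simp add: pair_dist_def prod.distrib)
  then show ?thesis
    using assms by (simp add: pair_dist_def prod.remove[of I j] power2_eq_square)
qed

lemma pair_dist_cong:
  "(\<And>i. i \<in> I \<Longrightarrow> w i = v i) \<Longrightarrow> pair_dist I w = pair_dist I v"
  by (simp add: pair_dist_def)

lemma pair_dist_nonneg: "pair_dist I w \<ge> 0"
  by (simp add: pair_dist_def prod_nonneg)

lemma pair_dist_pos_iff:
  assumes "finite I"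
  shows "pair_dist I w > 0 \<longleftrightarrow> inj_on w I"
proof -
  have "pair_dist I w > 0 \<longleftrightarrow> pair_dist I w \<noteq> 0"
    using pair_dist_nonneg[of I w] by linarith
  also have "\<dots> \<longleftrightarrow> inj_on w I"
    using assms by (auto simp: pair_dist_def inj_on_def)
  finally show ?thesis .
qed

lemma poly_pderiv_prod_linear:
  fixes w :: "'i \<Rightarrow> 'a::idom"
  assumes "finite I" "j \<in> I"
  shows "poly (pderiv (\<Prod>i\<in>I. [:- w i, 1:])) (w j) = (\<Prod>k\<in>I - {j}. w j - w k)"
proof -
  have "(\<Prod>i\<in>I. [:- w i, 1:]) = [:- w j, 1:] * (\<Prod>k\<in>I - {j}. [:- w k, 1:])"
    using assms by (simp add: prod.remove)
  then show ?thesis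
    by (simp add: pderiv_mult pderiv_pCons poly_prod del: mult_pCons_left)
qed

lemma poly_pderiv2_linear_mult:
  fixes q :: "'a::idom poly"
  shows "poly (pderiv (pderiv ([:- u, 1:] * q))) u = 2 * poly (pderiv q) u"
  by (simp add: pderiv_mult pderiv_pCons pderiv_add del: mult_pCons_left)

lemma degree_prod_linear:
  fixes w :: "'i \<Rightarrow> 'a::idom"
  assumes "finite I"
  shows "degree (\<Prod>i\<in>I. [:- w i, 1:]) = card I" "lead_coeff (\<Prod>i\<in>I. [:- w i, 1:]) = 1"
proof -
  show "degree (\<Prod>i\<in>I. [:- w i, 1:]) = card I"
    by (subst degree_prod_eq_sum_degree) auto
  show "lead_coeff (\<Prod>i\<in>I. [:- w i, 1:]) = 1"
    by (simp add: lead_coeff_prod)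
qed

text \<open>Conjugation is inversion on the unit circle, so it turns \<open>u / (u - v)\<close> into
  \<open>v / (v - u)\<close> with the roles reversed as \<open>- v / (u - v)\<close>, and the two
  add up to 1.\<close>

lemma Re_div_diff_unit:
  assumes "cmod u = 1" "cmod v = 1" "u \<noteq> v"
  shows "Re (u / (u - v)) = 1 / 2"
proof -
  have u: "u * cnj u = 1" "v * cnj v = 1"
    using assms by (simp_all add: complex_norm_square[symmetric])
  then have [simp]: "u \<noteq> 0" "v \<noteq> 0" by auto
  have c: "cnj u = 1 / u" "cnj v = 1 / v"
    using u by (simp_all add: field_simps)
  have "u / (u - v) + cnj (u / (u - v)) = 1"
    using assms(3) by (simp add: c divide_simps) (simp add: algebra_simps)
  then have "complex_of_real (2 * Re (u / (u - v))) = 1"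
    by (simp only: complex_add_cnj)
  then show ?thesis
    by (simp only: of_real_eq_1_iff)
qed

text \<open>Let L = u Q'(u) / Q(u), the sum of the u / (u - w_k). The derivative of log |Q| along
  the circle at \<open>u\<close> is -Im L, which vanishes at a maximum, and Re L is half the number
  of points because each summand has real part 1/2.\<close>

lemma stationary_on_circle:
  fixes w :: "'i \<Rightarrow> complex"
  defines "Q \<equiv> \<lambda>K. \<Prod>k\<in>K. [:- w k, 1:]"
  assumes K: "finite K" and w: "\<And>k. k \<in> K \<Longrightarrow> cmod (w k) = 1" and u: "cmod u = 1"
    and ne: "\<And>k. k \<in> K \<Longrightarrow> w k \<noteq> u"
    and max: "\<And>z. cmod z = 1 \<Longrightarrow> cmod (poly (Q K) z) \<le> cmod (poly (Q K) u)"
  shows "2 * u * poly (pderiv (Q K)) u = of_nat (card K) * poly (Q K) u"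
proof -
  define L where "L = (\<Sum>k\<in>K. u / (u - w k))"
  define q where "q = poly (Q K) u"
  have q0: "q \<noteq> 0"
    using ne K by (auto simp: q_def Q_def poly_prod)
  have "poly (Q (K - {k})) u = q / (u - w k)" if "k \<in> K" for k
    using K that ne[OF that] by (simp add: q_def Q_def poly_prod prod.remove[of K k] eq_divide_eq)
      (simp add: algebra_simps)
  then have L: "u * poly (pderiv (Q K)) u = L * q"
    by (simp add: Q_def pderiv_prod pderiv_pCons poly_sum L_def sum_distrib_left sum_distrib_right)
  \<comment> \<open>The curve \<open>u * cis t\<close> stays on the circle and passes through
    \<open>u\<close> at t = 0; the chain rule gives h'(0) = i L q.\<close>
  define h where "h = (\<lambda>t. poly (Q K) (u * cis t))"
  have "((\<lambda>t. u * cis t) has_vector_derivative (u * \<i>)) (at 0)"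
  proof -
    have "(cis has_vector_derivative (\<i> * cis 0)) (at 0)"
      using has_derivative_cis by (auto intro!: derivative_eq_intros simp: has_vector_derivative_def scaleR_conv_of_real)
    then show ?thesis
      by (auto intro!: derivative_eq_intros)
  qed
  moreover have "(poly (Q K) has_field_derivative poly (pderiv (Q K)) u) (at (u * cis 0))"
    by simp
  ultimately have "(poly (Q K) \<circ> (\<lambda>t. u * cis t) has_vector_derivative
      (u * \<i> * poly (pderiv (Q K)) u)) (at 0)"
    by (rule field_vector_diff_chain_at)
  moreover have "u * \<i> * poly (pderiv (Q K)) u = \<i> * L * q"
    using L by (metis mult.assoc mult.commute)
  ultimately have h: "(h has_vector_derivative (\<i> * L * q)) (at 0)"
    by (simp add: h_def o_def)
  have h0: "h 0 = q" by (simp add: h_def q_def)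
  have R: "((\<lambda>t. Re (h t)) has_real_derivative Re (\<i> * L * q)) (at 0)"
    and I: "((\<lambda>t. Im (h t)) has_real_derivative Im (\<i> * L * q)) (at 0)"
    using bounded_linear.has_vector_derivative[OF bounded_linear_Re h]
      bounded_linear.has_vector_derivative[OF bounded_linear_Im h]
    by (simp_all add: has_real_derivative_iff_has_vector_derivative)
  \<comment> \<open>The squared modulus avoids logarithms; its derivative is 2 Re (cnj q i L
    q).\<close>
  have "((\<lambda>t. (Re (h t))\<^sup>2 + (Im (h t))\<^sup>2) has_real_derivative - 2 * Im L * (cmod q)\<^sup>2) (at 0)"
    by (rule derivative_eq_intros R I refl)+
      (simp add: h0 cmod_power2, simp add: algebra_simps power2_eq_square)
  then have "- 2 * Im L * (cmod q)\<^sup>2 = 0"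
  proof (rule DERIV_local_max[where d = 1])
    have "(cmod (h t))\<^sup>2 \<le> (cmod (h 0))\<^sup>2" for t
      unfolding h_def by (rule power_mono) (use max u in \<open>auto simp: norm_mult\<close>)
    then show "\<forall>y. \<bar>0 - y\<bar> < 1 \<longrightarrow> (Re (h y))\<^sup>2 + (Im (h y))\<^sup>2 \<le> (Re (h 0))\<^sup>2 + (Im (h 0))\<^sup>2"
      by (simp add: cmod_power2)
  qed simp
  then have "Im L = 0" using q0 by simp
  moreover have "Re L = (\<Sum>k\<in>K. 1 / 2)"
    unfolding L_def Re_sum by (intro sum.cong Re_div_diff_unit u w) (use ne in auto)
  ultimately have "L = of_real (card K / 2)"
    by (simp add: complex_eq_iff)
  then have "2 * L = of_nat (card K)"
    by (simp add: mult.commute)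
  moreover have "2 * u * poly (pderiv (Q K)) u = 2 * L * q"
    using L by (simp only: mult.assoc)
  ultimately show ?thesis
    by (simp add: q_def)
qed

text \<open>The functions into the unit circle form a compact set in the product topology by
  Tychonoff's theorem, and \<open>pair_dist I\<close> is continuous on it. Values outside
  \<open>I\<close> are irrelevant and may be reset to 1.\<close>

lemma ex_max_pair_dist:
  fixes I :: "'i set"
  assumes "finite I"
  shows "\<exists>v. (\<forall>i. cmod (v i) = 1) \<and>
    (\<forall>w. (\<forall>i\<in>I. cmod (w i) = 1) \<longrightarrow> pair_dist I w \<le> pair_dist I v)"
proof -
  define S :: "('i \<Rightarrow> complex) set" where "S = (\<Pi>\<^sub>E i\<in>UNIV. sphere 0 1)"
  have S: "w \<in> S \<longleftrightarrow> (\<forall>i. cmod (w i) = 1)" for w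
    by (auto simp: S_def PiE_def)
  have "compactin (product_topology (\<lambda>_::'i. euclidean :: complex topology) UNIV) S"
    unfolding S_def by (subst compactin_PiE) auto
  then have "compact S"
    by (simp add: euclidean_product_topology)
  moreover have "(\<lambda>_. 1) \<in> S" by (simp add: S)
  moreover have "continuous_on S (pair_dist I)"
    unfolding pair_dist_def
    by (intro continuous_intros continuous_on_subset[OF continuous_on_product_coordinates]) auto
  ultimately obtain v where v: "v \<in> S" "\<And>w. w \<in> S \<Longrightarrow> pair_dist I w \<le> pair_dist I v"
    using continuous_attains_sup[of S "pair_dist I"] by blast
  have "pair_dist I w \<le> pair_dist I v" if "\<forall>i\<in>I. cmod (w i) = 1" for w
  proof -
    have "pair_dist I w = pair_dist I (\<lambda>i. if i \<in> I then w i else 1)"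
      by (rule pair_dist_cong) simp
    also have "\<dots> \<le> pair_dist I v"
      by (rule v) (use that in \<open>simp add: S\<close>)
    finally show ?thesis .
  qed
  with v show ?thesis by (auto simp: S)
qed

text \<open>Both sides are monic of degree \<open>card I\<close> and agree at the distinct points
  \<open>w i\<close>, of which there are \<open>card I\<close>.\<close>

lemma prod_linear_eq_monom:
  fixes w :: "'i \<Rightarrow> 'a::idom"
  assumes I: "finite I" "I \<noteq> {}" and inj: "inj_on w I"
    and c: "\<And>i. i \<in> I \<Longrightarrow> w i ^ card I = c"
  shows "(\<Prod>i\<in>I. [:- w i, 1:]) = monom 1 (card I) - [:c:]"
proof (rule poly_eqI_degree_lead_coeff[where A = "w ` I" and n = "card I"])
  have n: "card I > 0" using I by (simp add: card_gt_0_iff)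
  show "card I \<le> card (w ` I)" by (simp add: card_image[OF inj])
  show "degree (\<Prod>i\<in>I. [:- w i, 1:]) \<le> card I"
    using degree_prod_linear(1)[OF I(1), of w] by simp
  show "degree (monom 1 (card I) - [:c:]) \<le> card I"
    by (intro degree_diff_le) (auto simp: degree_monom_le)
  show "coeff (\<Prod>i\<in>I. [:- w i, 1:]) (card I) = coeff (monom 1 (card I) - [:c:]) (card I)"
    using degree_prod_linear[OF I(1), of w] n by (simp add: coeff_pCons split: nat.split)
  show "poly (\<Prod>i\<in>I. [:- w i, 1:]) x = poly (monom 1 (card I) - [:c:]) x" if "x \<in> w ` I" for x
    using that c I by (auto simp: poly_prod poly_monom)
qed

text \<open>For P = X^n - c with roots \<open>w i\<close>, the factor of \<open>pair_dist\<close> at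
  \<open>j\<close> is |P'(w_j)| = |n w_j^(n - 1)| = n.\<close>

lemma pair_dist_eq_of_power_eq:
  assumes I: "finite I" and inj: "inj_on w I" and w: "\<And>i. i \<in> I \<Longrightarrow> cmod (w i) = 1"
    and c: "\<And>i. i \<in> I \<Longrightarrow> w i ^ card I = c"
  shows "pair_dist I w = real (card I) ^ card I"
proof -
  have "(\<Prod>k\<in>I - {j}. cmod (w j - w k)) = card I" if "j \<in> I" for j
  proof -
    have "(\<Prod>k\<in>I - {j}. w j - w k) = poly (pderiv (\<Prod>i\<in>I. [:- w i, 1:])) (w j)"
      using poly_pderiv_prod_linear[OF I that, of w] by simp
    also have "\<dots> = poly (pderiv (monom 1 (card I) - [:c:])) (w j)"
      using I inj c that by (subst prod_linear_eq_monom) auto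
    also have "\<dots> = of_nat (card I) * w j ^ (card I - 1)"
      by (simp add: pderiv_diff pderiv_monom pderiv_pCons poly_monom)
    finally show ?thesis
      using w[OF that] by (metis (no_types) mult.right_neutral norm_mult norm_of_nat norm_power power_one prod_norm)
  qed
  then show ?thesis by (simp add: pair_dist_def)
qed

text \<open>Moving one point of a maximizer at a time gives a stationarity relation at each
  \<open>w j\<close>. Together they say that X P'' = (n - 1) P' holds at the n roots of P, hence
  identically by degree; the monic solutions of degree n are X^n plus a constant.\<close>

lemma power_eq_of_max_pair_dist:
  assumes I: "finite I" "I \<noteq> {}" and inj: "inj_on w I"
    and w: "\<And>i. i \<in> I \<Longrightarrow> cmod (w i) = 1"
    and max: "\<And>v. (\<And>i. i \<in> I \<Longrightarrow> cmod (v i) = 1) \<Longrightarrow> pair_dist I v \<le> pair_dist I w"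
  shows "\<exists>c. \<forall>i\<in>I. w i ^ card I = c"
proof -
  define n where "n = card I"
  have n: "n > 0" using I by (simp add: n_def card_gt_0_iff)
  define P where "P = (\<Prod>i\<in>I. [:- w i, 1:])"
  have dP: "degree P = n" "coeff P n = 1"
    using degree_prod_linear[OF I(1), of w] by (auto simp: P_def n_def)
  \<comment> \<open>At \<open>w j\<close>, the factorization P = (X - w_j) Q gives P' = Q and P'' =
    2 Q', so the stationarity relation for Q says exactly that \<open>R\<close> vanishes
    there.\<close>
  define R where "R = [:0, 1:] * pderiv (pderiv P) - smult (of_nat (n - 1)) (pderiv P)"
  have R: "poly R (w j) = 0" if j: "j \<in> I" for j
  proof -
    define Q where "Q = (\<Prod>k\<in>I - {j}. [:- w k, 1:])"
    have P: "P = [:- w j, 1:] * Q"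
      using I j by (simp add: P_def Q_def prod.remove)
    have pQ: "cmod (poly Q z) = (\<Prod>k\<in>I - {j}. cmod (z - w k))" for z
      by (simp add: Q_def poly_prod prod_norm)
    have "2 * w j * poly (pderiv Q) (w j) = of_nat (card (I - {j})) * poly Q (w j)"
      unfolding Q_def
    proof (rule stationary_on_circle)
      fix z assume z: "cmod z = 1"
      define v where "v = w(j := z)"
      have "pair_dist I v \<le> pair_dist I w"
        by (rule max) (use w z in \<open>simp add: v_def\<close>)
      moreover have "pair_dist I v = (cmod (poly Q z))\<^sup>2 * pair_dist (I - {j}) w"
      proof -
        have "pair_dist (I - {j}) v = pair_dist (I - {j}) w"
          by (rule pair_dist_cong) (simp add: v_def)
        moreover have "(\<Prod>k\<in>I - {j}. cmod (v j - v k)) = (\<Prod>k\<in>I - {j}. cmod (z - w k))"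
          by (rule prod.cong) (auto simp: v_def)
        ultimately show ?thesis
          by (simp add: pair_dist_remove[OF I(1) j] pQ)
      qed
      moreover have "pair_dist I w = (cmod (poly Q (w j)))\<^sup>2 * pair_dist (I - {j}) w"
        by (simp add: pair_dist_remove[OF I(1) j] pQ)
      \<comment> \<open>Distinctness of the points makes the common factor positive, so it
        cancels.\<close>
      moreover have "pair_dist (I - {j}) w > 0"
        using I inj by (subst pair_dist_pos_iff) (auto intro: inj_on_subset)
      ultimately have "(cmod (poly Q z))\<^sup>2 \<le> (cmod (poly Q (w j)))\<^sup>2"
        by simp
      then show "cmod (poly (\<Prod>k\<in>I - {j}. [:- w k, 1:]) z) \<le> cmod (poly (\<Prod>k\<in>I - {j}. [:- w k, 1:]) (w j))"
        unfolding Q_def by (rule power2_le_imp_le) simp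
    qed (use I w j inj in \<open>auto dest: inj_onD\<close>)
    moreover have "poly (pderiv (pderiv P)) (w j) = 2 * poly (pderiv Q) (w j)"
      unfolding P by (rule poly_pderiv2_linear_mult)
    moreover have "poly (pderiv P) (w j) = poly Q (w j)"
      unfolding P by (simp add: pderiv_mult pderiv_pCons del: mult_pCons_left)
    moreover have "card (I - {j}) = n - 1"
      using I j by (simp add: n_def)
    ultimately show ?thesis
      by (simp add: R_def mult_ac)
  qed
  \<comment> \<open>The factor k - (n - 1) vanishes only at k = n - 1, where the leading coefficient
    of P appears; so \<open>R\<close> = 0 forces the coefficients of P strictly between 0 and n to
    vanish.\<close>
  have cR: "coeff R k = of_nat (Suc k) * (of_nat k - of_nat (n - 1)) * coeff P (Suc k)" for k
    by (cases k) (simp_all add: R_def coeff_pderiv algebra_simps)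
  have "R = 0"
  proof (rule poly_eqI_degree[where A = "w ` I"])
    have "degree R < n"
    proof (rule degree_lessI)
      show "\<forall>k\<ge>n. coeff R k = 0"
        using dP by (auto simp: cR coeff_eq_0)
    qed (use n in auto)
    then show "degree R < card (w ` I)" "degree 0 < card (w ` I)"
      by (auto simp: card_image[OF inj] n_def)
  qed (use R in auto)
  then have zero: "coeff P k = 0" if "0 < k" "k < n" for k
    using cR[of "k - 1"] that \<open>R = 0\<close> by (auto simp del: of_nat_diff)
  have "P = monom 1 n - [:- coeff P 0:]"
  proof (rule poly_eqI)
    fix k
    show "coeff P k = coeff (monom 1 n - [:- coeff P 0:]) k"
      using zero[of k] dP n coeff_eq_0[of P k]
      by (cases k n rule: linorder_cases) (auto simp: coeff_pCons split: nat.split)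
  qed
  moreover have "poly P (w i) = 0" if "i \<in> I" for i
    using I that by (auto simp: P_def poly_prod)
  ultimately have "w i ^ n = - coeff P 0" if "i \<in> I" for i
    using that by (metis poly_diff poly_monom mult_1 poly_const_conv right_minus_eq)
  then show ?thesis by (auto simp: n_def)
qed

text \<open>A maximizer \<open>v\<close> exists by compactness, and its points have a common n-th
  power, which determines the maximal value n^n. Equality makes \<open>w\<close> a maximizer too, so
  the same conclusion applies to it.\<close>

theorem pair_dist_le:
  assumes I: "finite I" "I \<noteq> {}" and w: "\<And>i. i \<in> I \<Longrightarrow> cmod (w i) = 1"
  shows "pair_dist I w \<le> real (card I) ^ card I"
    and "pair_dist I w = real (card I) ^ card I \<Longrightarrow> inj_on w I \<and> (\<exists>c. \<forall>i\<in>I. w i ^ card I = c)"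
proof -
  have n: "card I > 0" using I by (simp add: card_gt_0_iff)
  obtain v where v: "\<forall>i. cmod (v i) = 1"
    and max: "\<And>w. \<forall>i\<in>I. cmod (w i) = 1 \<Longrightarrow> pair_dist I w \<le> pair_dist I v"
    using ex_max_pair_dist[OF I(1)] by blast
  \<comment> \<open>The n-th roots of unity serve as a configuration of n distinct points: they show
    that the maximum is positive, so the points of \<open>v\<close> are distinct.\<close>
  have "card I = card {z::complex. z ^ card I = 1}"
    using n by (simp add: card_roots_unity_eq)
  then obtain h :: "'a \<Rightarrow> complex" where h: "bij_betw h I {z. z ^ card I = 1}"
    using finite_same_card_bij[OF I(1) finite_roots_unity] n by (metis One_nat_def Suc_leI)
  have "\<forall>i\<in>I. cmod (h i) = 1"
    using bij_betwE[OF h] n power_eq_1_iff by (metis mem_Collect_eq not_gr_zero)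
  then have "pair_dist I h \<le> pair_dist I v" by (rule max)
  moreover have "pair_dist I h > 0"
    using h I by (simp add: pair_dist_pos_iff bij_betw_def)
  ultimately have inj: "inj_on v I"
    using I by (simp flip: pair_dist_pos_iff)
  have "\<exists>c. \<forall>i\<in>I. v i ^ card I = c"
    using power_eq_of_max_pair_dist[OF I inj] v max by auto
  then have val: "pair_dist I v = real (card I) ^ card I"
    using pair_dist_eq_of_power_eq[OF I(1) inj] v by blast
  show "pair_dist I w \<le> real (card I) ^ card I"
    using max[of w] w val by simp
  assume eq: "pair_dist I w = real (card I) ^ card I"
  then have inj: "inj_on w I"
    using I n by (simp flip: pair_dist_pos_iff)
  then show "inj_on w I \<and> (\<exists>c. \<forall>i\<in>I. w i ^ card I = c)"
    using power_eq_of_max_pair_dist[OF I inj w] max eq val by simp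
qed

section \<open>The Cayley transform of the roots\<close>

text \<open>Exchanging the indices maps the pairs below the diagonal to those above it. This
  converts the ordered pairs of \<open>pair_dist\<close> into the pairs j < k of
  \<open>root_disc\<close>.\<close>

lemma prod_off_diagonal:
  fixes g :: "nat \<Rightarrow> nat \<Rightarrow> 'a::comm_monoid_mult"
  assumes sym: "\<And>j k. g j k = g k j"
  shows "(\<Prod>j<n. \<Prod>k\<in>{..<n} - {j}. g j k) = (\<Prod>j<n. \<Prod>k\<in>{j<..<n}. g j k * g j k)"
proof -
  have "(\<Prod>j<n. \<Prod>k\<in>{..<n} - {j}. g j k) =
      (\<Prod>j<n. (\<Prod>k | k \<in> {..<n} \<and> k < j. g j k) * (\<Prod>k\<in>{j<..<n}. g j k))"
  proof (rule prod.cong)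
    fix j assume "j \<in> {..<n}"
    then have "{..<n} - {j} = {k \<in> {..<n}. k < j} \<union> {j<..<n}"
      by auto
    moreover have "prod (g j) ({k \<in> {..<n}. k < j} \<union> {j<..<n}) =
        prod (g j) {k \<in> {..<n}. k < j} * prod (g j) {j<..<n}"
      by (rule prod.union_disjoint) auto
    ultimately show "(\<Prod>k\<in>{..<n} - {j}. g j k) =
        (\<Prod>k | k \<in> {..<n} \<and> k < j. g j k) * (\<Prod>k\<in>{j<..<n}. g j k)"
      by simp
  qed simp
  also have "\<dots> = (\<Prod>j<n. \<Prod>k | k \<in> {..<n} \<and> k < j. g j k) * (\<Prod>j<n. \<Prod>k\<in>{j<..<n}. g j k)"
    by (rule prod.distrib)
  also have "(\<Prod>j<n. \<Prod>k | k \<in> {..<n} \<and> k < j. g j k) =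
      (\<Prod>k<n. \<Prod>j | j \<in> {..<n} \<and> k < j. g j k)"
    by (rule prod.swap_restrict) auto
  also have "\<dots> = (\<Prod>k<n. \<Prod>j\<in>{k<..<n}. g k j)"
    by (intro prod.cong sym) auto
  finally show ?thesis
    by (simp flip: prod.distrib)
qed

lemma monic_eq_prod_proots:
  fixes f :: "'a::idom poly"
  assumes "lead_coeff f = 1" "size (proots f) = degree f"
  shows "f = (\<Prod>x\<in>#proots f. [:- x, 1:])"
  using assms
proof (induction "degree f" arbitrary: f)
  case 0
  then show ?case
    by (auto elim!: degree_eq_zeroE)
next
  case (Suc n)
  then obtain x where "x \<in># proots f"
    by (metis multiset_nonemptyE size_empty nat.distinct(1))
  moreover have "f \<noteq> 0"
    using Suc.prems by auto
  ultimately have "poly f x = 0"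
    by simp
  then obtain g where f: "f = [:- x, 1:] * g"
    by (metis poly_eq_0_iff_dvd dvdE)
  have g0: "g \<noteq> 0" using f Suc.prems by auto
  have lg: "lead_coeff g = 1"
    using Suc.prems(1) unfolding f by (simp only: lead_coeff_mult) simp
  have dg: "degree f = Suc (degree g)"
    using g0 unfolding f by (subst degree_mult_eq) auto
  have pf: "proots f = {#x#} + proots g"
    using g0 unfolding f by (subst proots_mult) auto
  have "g = (\<Prod>x\<in>#proots g. [:- x, 1:])"
    using Suc lg dg pf by auto
  then show ?case
    by (simp add: pf del: mult_pCons_left) (metis f)
qed

lemma map_poly_of_real_prod_linear:
  assumes "finite I"
  shows "map_poly of_real (\<Prod>i\<in>I. [:- x i, 1:]) = (\<Prod>i\<in>I. [:- of_real (x i), 1 :: complex:])"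
  using assms
proof (induction I)
  case (insert i I)
  have "map_poly of_real ([:- y, 1:] * g) = [:- of_real y, 1 :: complex:] * map_poly of_real g" for y g
    by (rule poly_eqI) (simp add: coeff_map_poly coeff_pCons split: nat.split)
  with insert show ?case by (simp del: mult_pCons_left)
qed simp

definition cayley :: "real \<Rightarrow> real \<Rightarrow> complex" where
  "cayley a x = (of_real x - of_real a * \<i>) / (of_real x + of_real a * \<i>)"

lemma cayley_denom_nonzero: "a \<noteq> 0 \<Longrightarrow> complex_of_real x + complex_of_real a * \<i> \<noteq> 0"
  by (simp add: complex_eq_iff)

lemma cmod_cayley: "a \<noteq> 0 \<Longrightarrow> cmod (cayley a x) = 1"
  using cayley_denom_nonzero[of a x]
  by (simp add: cayley_def norm_divide divide_eq_1_iff) (simp add: cmod_def)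

lemma cayley_diff:
  assumes "a \<noteq> 0"
  shows "cayley a x - cayley a y = 2 * of_real a * \<i> * of_real (x - y) /
    ((of_real x + of_real a * \<i>) * (of_real y + of_real a * \<i>))"
proof -
  have "(X - A) / (X + A) - (Y - A) / (Y + A) = 2 * A * (X - Y) / ((X + A) * (Y + A))"
    if "X + A \<noteq> 0" "Y + A \<noteq> 0" for X Y A :: complex
  proof -
    have "(X - A) * (Y + A) - (Y - A) * (X + A) = 2 * A * (X - Y)"
      by (simp add: algebra_simps)
    then show ?thesis
      by (subst diff_frac_eq[OF that]) (rule arg_cong)
  qed
  from this[OF cayley_denom_nonzero cayley_denom_nonzero, OF assms assms]
  show ?thesis by (simp only: cayley_def of_real_diff) (simp only: mult.assoc)
qed

lemma inj_cayley: "a \<noteq> 0 \<Longrightarrow> inj (cayley a)"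
proof (rule injI)
  fix x y assume a: "a \<noteq> 0" and "cayley a x = cayley a y"
  then have "cayley a x - cayley a y = 0" by simp
  then show "x = y"
    using cayley_denom_nonzero[OF a, of x] cayley_denom_nonzero[OF a, of y] a
    by (subst (asm) cayley_diff) (auto simp flip: of_real_diff)
qed

text \<open>By \<open>cayley_diff\<close> each ordered pair contributes a factor 2a and a
  denominator |x_j + ai| |x_k + ai|. There are n (n - 1) ordered pairs, and each index lies in 2 (n
  - 1) of them.\<close>

lemma pair_dist_cayley:
  assumes a: "a > 0" and n: "n > 0"
  shows "pair_dist {..<n} (\<lambda>j. cayley a (x j)) *
      (\<Prod>j<n. cmod (of_real (x j) + of_real a * \<i>)) ^ (2 * n - 2) =
    (2 * a) ^ (n * (n - 1)) * (\<Prod>j<n. \<Prod>k\<in>{j<..<n}. (x j - x k)\<^sup>2)"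
proof -
  define c where "c j = cmod (of_real (x j) + of_real a * \<i>)" for j
  define M where "M = (\<Prod>j<n. c j)"
  have c: "c j > 0" for j
    using cayley_denom_nonzero[of a "x j"] a by (simp add: c_def)
  have M: "M > 0" unfolding M_def by (intro prod_pos c)
  have P: "(\<Prod>j<n. \<Prod>k\<in>{..<n} - {j}. c j * c k) = M ^ (2 * n - 2)"
  proof -
    have "(\<Prod>k\<in>{..<n} - {j}. c j * c k) = c j ^ (n - 1) * (M / c j)" if "j < n" for j
      using that c[of j] by (simp add: prod.distrib M_def prod.remove[of "{..<n}" j])
    then have "(\<Prod>j<n. \<Prod>k\<in>{..<n} - {j}. c j * c k) = M ^ (n - 1) * (M ^ n / M)"
      by (simp add: prod.distrib prod_dividef prod_power_distrib M_def)
    also have "M ^ n / M = M ^ (n - 1)"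
      using n M by (cases n) auto
    also have "M ^ (n - 1) * M ^ (n - 1) = M ^ (2 * n - 2)"
      by (simp flip: power_add mult_2 add: diff_mult_distrib2)
    finally show ?thesis .
  qed
  have "pair_dist {..<n} (\<lambda>j. cayley a (x j)) * M ^ (2 * n - 2) =
      (\<Prod>j<n. \<Prod>k\<in>{..<n} - {j}. cmod (cayley a (x j) - cayley a (x k)) * (c j * c k))"
    by (simp add: pair_dist_def prod.distrib flip: P)
  also have "\<dots> = (\<Prod>j<n. \<Prod>k\<in>{..<n} - {j}. 2 * a * \<bar>x j - x k\<bar>)"
  proof (intro prod.cong refl)
    fix j k
    have "cmod (cayley a (x j) - cayley a (x k)) = 2 * a * \<bar>x j - x k\<bar> / (c j * c k)"
      using a by (subst cayley_diff) (simp_all add: norm_mult norm_divide c_def del: of_real_diff)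
    then show "cmod (cayley a (x j) - cayley a (x k)) * (c j * c k) = 2 * a * \<bar>x j - x k\<bar>"
      using c[of j] c[of k] by simp
  qed
  also have "\<dots> = (\<Prod>j<n. \<Prod>k\<in>{..<n} - {j}. 2 * a) * (\<Prod>j<n. \<Prod>k\<in>{..<n} - {j}. \<bar>x j - x k\<bar>)"
    by (simp add: prod.distrib)
  also have "(\<Prod>j<n. \<Prod>k\<in>{..<n} - {j}. 2 * a) = (2 * a) ^ (n * (n - 1))"
    by (simp add: mult.commute[of n] power_mult)
  also have "(\<Prod>j<n. \<Prod>k\<in>{..<n} - {j}. \<bar>x j - x k\<bar>) = (\<Prod>j<n. \<Prod>k\<in>{j<..<n}. (x j - x k)\<^sup>2)"
    by (subst prod_off_diagonal) (simp_all add: abs_minus_commute power2_eq_square flip: abs_mult)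
  finally show ?thesis by (simp add: M_def c_def)
qed

text \<open>At ai the factored polynomial has modulus the product of the |ai - x_j|, and |ai - x_j|
  = |x_j + ai| for real x_j. So \<open>m\<close> is the product of the moduli of the denominators of
  the Cayley transforms.\<close>

lemma admissible_roots:
  assumes "admissible a d m f"
  obtains x where "f = (\<Prod>j<d. [:- x j, 1:])"
    and "discr f = (\<Prod>j<d. \<Prod>k\<in>{j<..<d}. (x j - x k)\<^sup>2)"
    and "m = (\<Prod>j<d. cmod (of_real (x j) + of_real a * \<i>))"
proof
  define xs where "xs = sorted_list_of_multiset (proots f)"
  then have xs: "proots f = mset xs"
    by simp
  then have len: "length xs = d"
    using assms by (simp add: admissible_def)
  have "f = (\<Prod>x\<in>#proots f. [:- x, 1:])"
    using assms by (intro monic_eq_prod_proots) (auto simp: admissible_def)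
  also have "\<dots> = (\<Prod>x\<leftarrow>xs. [:- x, 1:])"
    unfolding xs by (simp only: mset_map[symmetric] prod_mset_prod_list)
  also have "\<dots> = (\<Prod>j<d. [:- (xs ! j), 1:])"
    by (subst prod.list_conv_set_nth) (simp add: len lessThan_atLeast0)
  finally show f: "f = (\<Prod>j<d. [:- (xs ! j), 1:])" .
  show "discr f = (\<Prod>j<d. \<Prod>k\<in>{j<..<d}. (xs ! j - xs ! k)\<^sup>2)"
    by (simp add: discr_def root_disc_def len flip: xs_def)
  have "m = cmod (poly (map_poly complex_of_real f) (complex_of_real a * \<i>))"
    using assms by (simp add: admissible_def)
  also have "\<dots> = (\<Prod>j<d. cmod (complex_of_real a * \<i> - of_real (xs ! j)))"
    by (subst f) (simp add: map_poly_of_real_prod_linear poly_prod prod_norm)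
  also have "\<dots> = (\<Prod>j<d. cmod (of_real (xs ! j) + of_real a * \<i>))"
    by (intro prod.cong) (simp_all add: cmod_def power2_commute)
  finally show "m = (\<Prod>j<d. cmod (of_real (xs ! j) + of_real a * \<i>))" .
qed

section \<open>Polynomials whose roots have Cayley transforms with a common d-th power\<close>

text \<open>Clearing denominators in \<open>cayley a x ^ d = c\<close> gives (x - ai)^d - c (x +
  ai)^d; division by 1 - c makes it monic.\<close>

definition circ_poly :: "real \<Rightarrow> nat \<Rightarrow> complex \<Rightarrow> complex poly" where
  "circ_poly a d c = smult (1 / (1 - c))
     ([:- (complex_of_real a * \<i>), 1:] ^ d - smult c ([:complex_of_real a * \<i>, 1:] ^ d))"

lemma poly_circ_poly:
  "poly (circ_poly a d c) z =
     ((z - of_real a * \<i>) ^ d - c * (z + of_real a * \<i>) ^ d) / (1 - c)"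
  by (simp add: circ_poly_def poly_power add.commute)

lemma degree_circ_poly:
  assumes "c \<noteq> 1"
  shows "degree (circ_poly a d c) = d" "lead_coeff (circ_poly a d c) = 1"
proof -
  have coeff: "coeff (circ_poly a d c) d = 1"
    using assms by (simp add: circ_poly_def coeff_linear_power)
  have "degree (circ_poly a d c) \<le> d"
    unfolding circ_poly_def
    by (intro degree_smult_le[THEN order_trans] degree_diff_le) (auto simp: degree_linear_power)
  with coeff show "degree (circ_poly a d c) = d"
    by (metis antisym le_degree zero_neq_one)
  with coeff show "lead_coeff (circ_poly a d c) = 1" by simp
qed

lemma circ_poly_root_cayley:
  assumes "a \<noteq> 0" "c \<noteq> 1"
  shows "poly (circ_poly a d c) (of_real x) = 0 \<longleftrightarrow> cayley a x ^ d = c"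
proof -
  have "cayley a x ^ d = c \<longleftrightarrow> (of_real x - of_real a * \<i>) ^ d = c * (of_real x + of_real a * \<i>) ^ d"
    unfolding cayley_def power_divide
    by (rule nonzero_divide_eq_eq) (use cayley_denom_nonzero[OF assms(1), of x] in auto)
  then show ?thesis
    using assms(2) by (simp only: poly_circ_poly divide_eq_0_iff right_minus_eq) auto
qed

text \<open>At a multiple root, u = z - ai and v = z + ai would satisfy u^d = c v^d and u^(d - 1) =
  c v^(d - 1), hence u^(d - 1) v = u^d. Since u and v differ, u = 0 and then v = 0, which is
  impossible.\<close>

lemma poly_pderiv_circ_poly_nonzero:
  assumes a: "a \<noteq> 0" and c: "c \<noteq> 0" "c \<noteq> 1" and d: "d > 0"
    and root: "poly (circ_poly a d c) z = 0"
  shows "poly (pderiv (circ_poly a d c)) z \<noteq> 0"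
proof
  define u v where "u = z - of_real a * \<i>" and "v = z + of_real a * \<i>"
  have r: "u ^ d = c * v ^ d"
    using root c by (simp add: poly_circ_poly u_def v_def)
  assume "poly (pderiv (circ_poly a d c)) z = 0"
  then have "of_nat d * u ^ (d - 1) = c * (of_nat d * v ^ (d - 1))"
    using c by (simp add: circ_poly_def pderiv_smult pderiv_diff pderiv_power pderiv_pCons poly_power
        u_def v_def add.commute del: pderiv_power_Suc)
  then have "u ^ (d - 1) = c * v ^ (d - 1)"
    using d by (simp add: mult.left_commute[of c])
  then have "u ^ (d - 1) * v = c * v ^ d"
    using d by (cases d) (auto simp: mult_ac)
  then have "u ^ (d - 1) * v = u ^ (d - 1) * u"
    using r d by (cases d) (auto simp: mult_ac)
  moreover have "v \<noteq> u" using a by (simp add: u_def v_def eq_neg_iff_add_eq_0)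
  ultimately have u: "u = 0" "d - 1 > 0" by (auto split: if_splits)
  then have "v = 0"
    using r d c by (simp add: power_0_left)
  with \<open>v \<noteq> u\<close> u show False by simp
qed

text \<open>The polynomials (X - ai)^d - c (X + ai)^d and (1 - c) f have degree at most d, the same
  coefficient at X^d and the d distinct roots of f as common zeros, so they coincide.\<close>

lemma cayley_power_eq_imp_circ_poly:
  assumes a: "a > 0" and d: "d > 0" and f: "f = (\<Prod>j<d. [:- x j, 1:])"
    and inj: "inj_on x {..<d}" and c: "\<And>j. j < d \<Longrightarrow> cayley a (x j) ^ d = c"
  shows "c \<noteq> 1" "map_poly complex_of_real f = circ_poly a d c"
proof -
  define p where "p = map_poly complex_of_real f"
  have p: "p = (\<Prod>j<d. [:- of_real (x j), 1:])"
    by (simp add: p_def f map_poly_of_real_prod_linear)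
  have dp: "degree p = d" "lead_coeff p = 1"
    using degree_prod_linear[of "{..<d}" "\<lambda>j. complex_of_real (x j)"] by (simp_all add: p)
  define h where "h = [:- (complex_of_real a * \<i>), 1:] ^ d - smult c ([:complex_of_real a * \<i>, 1:] ^ d)"
  have h: "h = smult (1 - c) p"
  proof (rule poly_eqI_degree_lead_coeff[where n = d and A = "(\<lambda>j. complex_of_real (x j)) ` {..<d}"])
    show "degree h \<le> d" unfolding h_def
      by (intro degree_diff_le degree_smult_le[THEN order_trans]) (auto simp: degree_linear_power)
    show "degree (smult (1 - c) p) \<le> d" using dp degree_smult_le by metis
    show "coeff h d = coeff (smult (1 - c) p) d"
      using dp by (simp add: h_def coeff_linear_power)
    have "inj_on (\<lambda>j. complex_of_real (x j)) {..<d}"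
      using inj by (auto simp: inj_on_def)
    then show "d \<le> card ((\<lambda>j. complex_of_real (x j)) ` {..<d})"
      by (simp add: card_image)
    fix z assume "z \<in> (\<lambda>j. complex_of_real (x j)) ` {..<d}"
    then obtain j where j: "j < d" "z = of_real (x j)" by auto
    have "poly p z = 0" using j by (auto simp: p poly_prod)
    moreover have "poly h z = 0"
      using c[OF j(1)] cayley_denom_nonzero[of a "x j"] a
      by (auto simp: h_def j poly_power cayley_def power_divide add.commute)
    ultimately show "poly h z = poly (smult (1 - c) p) z" by simp
  qed
  have c0: "c \<noteq> 0" using c[of 0] d cmod_cayley[of a "x 0"] a by auto
  \<comment> \<open>The power (X - ai)^d vanishes at ai, leaving -c (2ai)^d; so \<open>h\<close> is
    not 0, which rules out c = 1.\<close>
  have "poly h (of_real a * \<i>) \<noteq> 0"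
    using c0 a d by (simp add: h_def poly_power power_0_left)
  then show c1: "c \<noteq> 1" using h by auto
  then show "map_poly complex_of_real f = circ_poly a d c"
    using h by (simp add: circ_poly_def flip: h_def p_def)
qed

text \<open>The substitution of -x exchanges the two d-th powers up to the sign (-1)^d; expanding
  the fraction by -1/c restores the shape of \<open>circ_poly\<close>. For |c| = 1 the new parameter
  is the conjugate of \<open>c\<close>.\<close>

lemma reflect_circ_poly:
  assumes "c \<noteq> 0" "c \<noteq> 1"
  shows "smult ((-1) ^ d) (circ_poly a d c \<circ>\<^sub>p [:0, -1:]) = circ_poly a d (1 / c)"
proof (rule poly_ext)
  fix z :: complex
  define u v where "u = z - of_real a * \<i>" and "v = z + of_real a * \<i>"
  have eq: "- z - of_real a * \<i> = (-1) * v" "- z + of_real a * \<i> = (-1) * u"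
    by (simp_all add: u_def v_def)
  have "poly (smult ((-1) ^ d) (circ_poly a d c \<circ>\<^sub>p [:0, -1:])) z =
      (-1) ^ d * (((-1) ^ d * v ^ d - c * ((-1) ^ d * u ^ d)) / (1 - c))"
    unfolding power_mult_distrib[symmetric] eq[symmetric]
    by (simp add: poly_pcompose poly_circ_poly)
  also have "\<dots> = ((-1) ^ d * (-1) ^ d) * ((v ^ d - c * u ^ d) / (1 - c))"
    by (simp add: algebra_simps diff_divide_distrib)
  also have "(-1) ^ d * (-1) ^ d = (1::complex)"
    by (simp flip: power_mult_distrib)
  also have "1 * ((v ^ d - c * u ^ d) / (1 - c)) = (u ^ d - 1 / c * v ^ d) / (1 - 1 / c)"
    using assms by (simp add: divide_simps) (simp add: algebra_simps)
  finally show "poly (smult ((-1) ^ d) (circ_poly a d c \<circ>\<^sub>p [:0, -1:])) z = poly (circ_poly a d (1 / c)) z"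
    by (simp add: poly_circ_poly u_def v_def)
qed

text \<open>The points of \<open>A\<close> already use up the degree, which leaves no room for
  multiplicities or further roots.\<close>

lemma proots_eq_mset_set:
  fixes p :: "'a::idom poly"
  assumes "p \<noteq> 0" "finite A" "degree p = card A" "\<And>x. x \<in> A \<Longrightarrow> poly p x = 0"
  shows "proots p = mset_set A"
proof -
  have "mset_set A \<subseteq># proots p"
    using assms by (auto simp: subseteq_mset_def count_mset_set' order_root intro!: Suc_leI)
  moreover have "size (proots p) \<le> size (mset_set A)"
    using size_proots_le[of p] assms by simp
  ultimately show ?thesis
    by (metis mset_subset_size order_less_le_trans less_irrefl subset_mset.le_imp_less_or_eq)
qed

section \<open>The extremal polynomial\<close>

lemma disc_bound_pos: "a > 0 \<Longrightarrow> d > 0 \<Longrightarrow> m > 0 \<Longrightarrow> disc_bound a d m > 0"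
  by (simp add: disc_bound_def)

lemma extremal_p_pos: "a > 0 \<Longrightarrow> d > 0 \<Longrightarrow> D > 0 \<Longrightarrow> extremal_p a d D > 0"
  by (simp add: extremal_p_def)

text \<open>Inserting D cancels the powers of d, and p <= 1 becomes m >= 2^(d - 1) a^d. The identity
  is checked after taking logarithms, where the real exponents turn into coefficients.\<close>

lemma extremal_p_disc_bound:
  assumes a: "a > 0" and d: "d \<ge> 2" and m: "m > 0"
  shows "extremal_p a d (disc_bound a d m) = 2 ^ (d - 1) * a ^ d / m"
proof -
  define e where "e = real d - 1"
  have e: "e > 0" "real d = e + 1" "real (d - 1) = e" "real (2 * d - 2) = 2 * e"
    "real (d * (d - 1)) = (e + 1) * e" "2 * real d - 2 = 2 * e"
    using d by (simp_all add: e_def of_nat_diff)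
  have D: "disc_bound a d m > 0"
    using a d m by (simp add: disc_bound_pos)
  have "ln (disc_bound a d m) =
      2 * e * ln m + (e + 1) * ln (real d) - (e + 1) * e * (ln 2 + ln a)"
    using a d m unfolding disc_bound_def
    by (simp add: ln_div ln_mult ln_realpow e(3-5) del: of_nat_mult of_nat_diff One_nat_def)
      (simp add: e(2) algebra_simps)
  then have "1 / (2 * e) * ln (disc_bound a d m) =
      ln m + (e + 1) / (2 * e) * ln (real d) - (e + 1) / 2 * (ln 2 + ln a)"
    using e(1) by (simp add: field_simps)
  moreover have "ln (extremal_p a d (disc_bound a d m)) =
      (e + 1) / 2 * ln a + ((e + 1) / 2 - 1) * ln 2 + (e + 1) / (2 * e) * ln (real d) -
      1 / (2 * e) * ln (disc_bound a d m)"
    using a d D unfolding extremal_p_def by (simp add: ln_mult ln_powr e(6)) (simp add: e(2))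
  ultimately have "ln (extremal_p a d (disc_bound a d m)) = e * ln 2 + (e + 1) * ln a - ln m"
    by (simp add: algebra_simps add_divide_distrib)
  also have "\<dots> = ln (2 ^ (d - 1) * a ^ d / m)"
    using a m by (simp add: ln_div ln_mult ln_realpow e(3) del: of_nat_diff One_nat_def)
      (simp add: e(2))
  finally show ?thesis
    using a d m D extremal_p_pos[of a d] by (subst (asm) ln_inj_iff) auto
qed

text \<open>The product of powers under the root is 1 / p^2 for p = \<open>extremal_p a d D\<close>,
  again by comparing logarithms. For p <= 1 the root is thus tan (arccos p), which links B to the
  angle.\<close>

lemma extremal_B_eq:
  assumes a: "a > 0" and d: "d \<ge> 2" and D: "D > 0"
  shows "extremal_B a d D = a * real d * ((-1) ^ d * sqrt (1 / (extremal_p a d D)\<^sup>2 - 1))"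
proof -
  define e where "e = real d - 1"
  have e: "e > 0" "real d = e + 1" "2 * real d - 2 = 2 * e"
    using d by (simp_all add: e_def)
  have p: "extremal_p a d D > 0"
    using a d D by (simp add: extremal_p_pos)
  define q where "q = a powr (- real d) * 2 powr (2 - real d) * real d powr (- real d / (real d - 1))
             * D powr (1 / (real d - 1))"
  have q: "q > 0" using a d D by (simp add: q_def)
  have "ln q = - (e + 1) * ln a + (1 - e) * ln 2 - (e + 1) / e * ln (real d) + 1 / e * ln D"
    using a d D unfolding q_def by (simp add: ln_mult ln_powr flip: e_def) (simp add: e(2) algebra_simps)
  moreover have "ln (extremal_p a d D) =
      (e + 1) / 2 * ln a + ((e + 1) / 2 - 1) * ln 2 + (e + 1) / (2 * e) * ln (real d) -
      1 / (2 * e) * ln D"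
    using a d D unfolding extremal_p_def by (simp add: ln_mult ln_powr e(3)) (simp add: e(2))
  moreover have "(e + 1) / (2 * e) = (e + 1) / e / 2" "1 / (2 * e) = 1 / e / 2"
    by simp_all
  moreover have "- (e + 1) * A + (1 - e) * B - r * C + i * E =
      - 2 * ((e + 1) / 2 * A + ((e + 1) / 2 - 1) * B + r / 2 * C - i / 2 * E)" for A B C E r i :: real
    by (simp add: field_simps)
  ultimately have "ln q = - 2 * ln (extremal_p a d D)"
    by (simp only:)
  also have "\<dots> = ln (1 / (extremal_p a d D)\<^sup>2)"
    using p by (simp add: ln_div ln_realpow)
  finally have "q = 1 / (extremal_p a d D)\<^sup>2"
    using p q by (subst (asm) ln_inj_iff) auto
  then show ?thesis
    by (simp add: extremal_B_def q_def)
qed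

lemma cmod_one_minus_sq: "cmod c = 1 \<Longrightarrow> (cmod (1 - c))\<^sup>2 = 2 - 2 * Re c"
  unfolding cmod_power2 by (simp add: cmod_def power2_eq_square algebra_simps)

text \<open>|1 - c|^2 = 2 - 2 Re c determines the real part, and the unit modulus then fixes the
  imaginary part up to sign.\<close>

lemma unit_eq_or_cnj:
  assumes "cmod b = 1" "cmod c = 1" "cmod (1 - b) = cmod (1 - c)"
  shows "b = c \<or> b = cnj c"
proof -
  have re: "Re b = Re c"
    using cmod_one_minus_sq[of b] cmod_one_minus_sq[of c] assms by simp
  moreover have "(Re b)\<^sup>2 + (Im b)\<^sup>2 = 1" "(Re c)\<^sup>2 + (Im c)\<^sup>2 = 1"
    using assms(1,2) by (simp_all flip: cmod_power2)
  ultimately have "(Im b)\<^sup>2 = (Im c)\<^sup>2" by simp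
  with re show ?thesis
    by (auto simp: power2_eq_iff complex_eq_iff)
qed

text \<open>For B = a d t and s = it the coefficients in F are (1 - s) / 2 at (x + ai)^d and (1 + s)
  / 2 at (x - ai)^d. Minus their quotient is the parameter c, and 1 - c = 2 / (1 + s) matches the
  normalization.\<close>

lemma extremal_poly_eq_circ_poly:
  assumes "a > 0" "d > 0"
  shows "extremal_poly a d (a * real d * t) =
    circ_poly a d (- (1 - of_real t * \<i>) / (1 + of_real t * \<i>))"
proof (rule poly_ext)
  fix z :: complex
  define r where "r = complex_of_real (a * real d)"
  define s where "s = complex_of_real t * \<i>"
  define U V where "U = (z + of_real a * \<i>) ^ d" and "V = (z - of_real a * \<i>) ^ d"
  have r: "r \<noteq> 0" using assms by (simp add: r_def)
  have s: "1 + s \<noteq> 0" "1 - - (1 - s) / (1 + s) = 2 / (1 + s)"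
  proof -
    show *: "1 + s \<noteq> 0" by (simp add: s_def complex_eq_iff)
    then show "1 - - (1 - s) / (1 + s) = 2 / (1 + s)"
      by (simp add: divide_simps)
  qed
  have "poly (extremal_poly a d (a * real d * t)) z =
      1 / (2 * r) * ((r - r * s) * U + (r + r * s) * V)"
    by (simp add: extremal_poly_def poly_power r_def s_def U_def V_def mult_ac add.commute)
  also have "\<dots> = ((1 - s) * U + (1 + s) * V) / 2"
    using r by (simp add: field_simps)
  also have "\<dots> = (V - - (1 - s) / (1 + s) * U) / (1 - - (1 - s) / (1 + s))"
  proof -
    have "(1 + s) * (V - - (1 - s) / (1 + s) * U) = (1 - s) * U + (1 + s) * V"
    proof -
      have "(1 + s) * (V - w * U) = (1 + s) * V - (1 + s) * w * U" for w
        by (simp add: algebra_simps)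
      moreover have "(1 + s) * (- (1 - s) / (1 + s)) = - (1 - s)"
        using s(1) by simp
      ultimately show ?thesis
        by (simp only:) (simp add: algebra_simps)
    qed
    then show ?thesis
      unfolding s(2) by (simp add: mult.commute)
  qed
  also have "\<dots> = poly (circ_poly a d (- (1 - s) / (1 + s))) z"
    by (simp only: poly_circ_poly U_def V_def)
  finally show "poly (extremal_poly a d (a * real d * t)) z =
      poly (circ_poly a d (- (1 - of_real t * \<i>) / (1 + of_real t * \<i>))) z"
    by (simp only: s_def)
qed

text \<open>Up to the common factor a / cos \<theta>, the numerator and the denominator of the
  transform are -i e^(i\<theta>) and i e^(-i\<theta>).\<close>

lemma cayley_tan:
  assumes "a > 0" "cos \<theta> \<noteq> 0"
  shows "cayley a (a * tan \<theta>) = - cis (2 * \<theta>)"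
proof -
  define C S where "C = complex_of_real (cos \<theta>)" and "S = complex_of_real (sin \<theta>)"
  have C: "C \<noteq> 0" using assms by (simp add: C_def)
  have cs: "C + \<i> * S = cis \<theta>" "C - \<i> * S = cis (- \<theta>)"
    by (simp_all add: C_def S_def complex_eq_iff)
  have "cayley a (a * tan \<theta>) = (of_real a * (S / C) - of_real a * \<i>) / (of_real a * (S / C) + of_real a * \<i>)"
    by (simp add: cayley_def tan_def C_def S_def)
  also have "\<dots> = (of_real a / C * (S - \<i> * C)) / (of_real a / C * (S + \<i> * C))"
    using C by (simp add: field_simps)
  also have "\<dots> = (S - \<i> * C) / (S + \<i> * C)"
    using C assms by simp
  also have "\<dots> = (- \<i> * cis \<theta>) / (\<i> * cis (- \<theta>))"
    unfolding cs[symmetric] by (simp add: algebra_simps)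
  also have "\<dots> = - cis (2 * \<theta>)"
    by (simp add: cis_divide)
  finally show ?thesis .
qed

text \<open>By \<open>cayley_tan\<close> the transforms of the listed points differ by d-th roots of
  unity: they have the common d-th power \<open>c\<close>, and they are distinct, so they exhaust
  the degree.\<close>

lemma proots_circ_poly_tan:
  assumes a: "a > 0" and d: "d > 0" and c: "c = (-1) ^ d * cis (2 * real d * \<gamma>)" "c \<noteq> 1"
  shows "proots (circ_poly a d c) =
    image_mset (\<lambda>k. complex_of_real (a * tan (\<gamma> + real k * pi / real d))) (mset_set {0..<d})"
proof -
  define \<theta> where "\<theta> k = \<gamma> + real k * pi / real d" for k
  have pow: "(- cis (2 * \<theta> k)) ^ d = c" for k
  proof -
    have "real d * (2 * \<theta> k) = 2 * real d * \<gamma> + 2 * pi * real k"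
      using d by (simp add: \<theta>_def field_simps)
    then have "cis (2 * \<theta> k) ^ d = cis (2 * real d * \<gamma>) * cis (2 * pi * real k)"
      by (simp only: Complex.DeMoivre cis_mult)
    then show ?thesis
      by (simp add: power_minus[of "cis _"] c(1) cis_multiple_2pi)
  qed
  \<comment> \<open>A pole of the tangent would correspond to the point 1 of the circle, whose d-th
    power 1 differs from \<open>c\<close>.\<close>
  have cos: "cos (\<theta> k) \<noteq> 0" for k
  proof
    assume "cos (\<theta> k) = 0"
    then have "- cis (2 * \<theta> k) = 1"
      by (simp add: complex_eq_iff cos_double sin_double) (metis add_0 power_zero_numeral sin_cos_squared_add2)
    with pow[of k] c(2) show False by simp
  qed
  have inj: "inj_on (\<lambda>k. complex_of_real (a * tan (\<theta> k))) {0..<d}"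
  proof (rule inj_onI)
    fix j k assume jk: "j \<in> {0..<d}" "k \<in> {0..<d}"
      and "complex_of_real (a * tan (\<theta> j)) = complex_of_real (a * tan (\<theta> k))"
    then have "cayley a (a * tan (\<theta> j)) = cayley a (a * tan (\<theta> k))"
      by (simp only: of_real_eq_iff)
    then have "cis (2 * \<theta> j) = cis (2 * \<theta> k)"
      using a cos by (simp add: cayley_tan)
    moreover have "cis (2 * \<theta> i) = cis (2 * \<gamma>) * cis (2 * pi * real i / real d)" for i
      by (simp add: \<theta>_def cis_mult algebra_simps)
    ultimately have "cis (2 * pi * real j / real d) = cis (2 * pi * real k / real d)"
      by simp
    then show "j = k"
      using Complex.bij_betw_roots_unity[OF d] jk unfolding bij_betw_def inj_on_def by auto
  qed
  have "proots (circ_poly a d c) = mset_set ((\<lambda>k. complex_of_real (a * tan (\<theta> k))) ` {0..<d})"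
  proof (rule proots_eq_mset_set)
    show "degree (circ_poly a d c) = card ((\<lambda>k. complex_of_real (a * tan (\<theta> k))) ` {0..<d})"
      by (simp only: card_image[OF inj] degree_circ_poly(1)[OF c(2)]) simp
    then show "circ_poly a d c \<noteq> 0"
      using degree_circ_poly(2)[OF c(2), of a d] by auto
    show "poly (circ_poly a d c) z = 0"
      if "z \<in> (\<lambda>k. complex_of_real (a * tan (\<theta> k))) ` {0..<d}" for z
    proof -
      from that obtain k where k: "z = complex_of_real (a * tan (\<theta> k))" by auto
      have "cayley a (a * tan (\<theta> k)) ^ d = c"
        by (simp only: cayley_tan[OF a cos] pow)
      then show ?thesis
        unfolding k by (subst circ_poly_root_cayley) (use a c(2) in auto)
    qed
  qed simp
  then show ?thesis
    by (simp only: image_mset_mset_set[OF inj] \<theta>_def[symmetric])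
qed

text \<open>For \<phi> = arccos p the root is tan \<phi>, and 1 + i tan \<phi> = cis \<phi> / p. The
  sign in \<open>t\<close> decides whether the quotient yields 2 \<phi> or -2 \<phi>; for even
  \<open>d\<close> the remaining minus sign turns -2 \<phi> into pi - 2 \<phi> = 2 arcsin p, hence
  the case distinction in the angle.\<close>

lemma cis_extremal_angle:
  assumes p: "0 < p" "p \<le> 1" and d: "d > 0"
  defines "t \<equiv> (-1) ^ d * sqrt (1 / p\<^sup>2 - 1)"
  shows "- (1 - of_real t * \<i>) / (1 + of_real t * \<i>) = (-1) ^ d * cis (2 * real d * extremal_angle d p)"
proof -
  define s \<phi> where "s = sqrt (1 / p\<^sup>2 - 1)" and "\<phi> = arccos p"
  have s: "s = sqrt (1 - p\<^sup>2) / p"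
  proof -
    have "1 / p\<^sup>2 - 1 = (1 - p\<^sup>2) / p\<^sup>2"
      using p by (simp add: diff_divide_distrib)
    then show ?thesis
      using p by (simp add: s_def real_sqrt_divide)
  qed
  have plus: "1 + of_real s * \<i> = cis \<phi> / of_real p"
    and minus: "1 - of_real s * \<i> = cis (- \<phi>) / of_real p"
    using p by (simp_all add: complex_eq_iff s \<phi>_def sin_arccos cos_arccos)
  have p0: "complex_of_real p \<noteq> 0" using p by simp
  show ?thesis
  proof (cases "odd d")
    case True
    then have "- (1 - of_real t * \<i>) / (1 + of_real t * \<i>) = - (cis \<phi> / of_real p) / (cis (- \<phi>) / of_real p)"
      by (simp add: t_def plus[symmetric] minus[symmetric] flip: s_def)
    also have "\<dots> = - cis (2 * \<phi>)"
      using p0 by (simp add: cis_divide)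
    finally show ?thesis
      using True d by (simp add: extremal_angle_def \<phi>_def)
  next
    case False
    then have "- (1 - of_real t * \<i>) / (1 + of_real t * \<i>) = - (cis (- \<phi>) / of_real p) / (cis \<phi> / of_real p)"
      by (simp add: t_def plus[symmetric] minus[symmetric] flip: s_def)
    also have "\<dots> = - cis (- 2 * \<phi>)"
      using p0 by (simp add: cis_divide)
    also have "\<dots> = cis (pi + - 2 * \<phi>)"
      by (simp only: cis_mult[symmetric] cis_pi) simp
    also have "pi + - 2 * \<phi> = 2 * arcsin p"
      using p by (simp add: \<phi>_def arcsin_arccos_eq)
    finally show ?thesis
      using False d by (simp add: extremal_angle_def)
  qed
qed

section \<open>The discriminant bound and its equality case\<close>

lemma discr_eq_pair_dist:
  assumes a: "a > 0" and d: "d > 0" and m: "m > 0"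
    and D: "\<Delta> = (\<Prod>j<d. \<Prod>k\<in>{j<..<d}. (x j - x k)\<^sup>2)"
    and mx: "m = (\<Prod>j<d. cmod (of_real (x j) + of_real a * \<i>))"
  shows "\<Delta> * real d ^ d = pair_dist {..<d} (\<lambda>j. cayley a (x j)) * disc_bound a d m"
proof -
  have "pair_dist {..<d} (\<lambda>j. cayley a (x j)) * m ^ (2 * d - 2) = (2 * a) ^ (d * (d - 1)) * \<Delta>"
    using pair_dist_cayley[OF a d, of x] by (simp only: D mx)
  then show ?thesis
    using a by (simp add: disc_bound_def field_simps)
qed

lemma discr_le_disc_bound:
  assumes a: "a > 0" and d: "d > 0" and m: "m > 0" and f: "admissible a d m f"
  shows "discr f \<le> disc_bound a d m"
proof -
  from f obtain x where x: "f = (\<Prod>j<d. [:- x j, 1:])"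
    "discr f = (\<Prod>j<d. \<Prod>k\<in>{j<..<d}. (x j - x k)\<^sup>2)"
    "m = (\<Prod>j<d. cmod (of_real (x j) + of_real a * \<i>))"
    by (rule admissible_roots)
  have "pair_dist {..<d} (\<lambda>j. cayley a (x j)) \<le> real d ^ d"
    using pair_dist_le(1)[of "{..<d}" "\<lambda>j. cayley a (x j)"] a d by (auto simp: cmod_cayley)
  then have "discr f * real d ^ d \<le> real d ^ d * disc_bound a d m"
    unfolding discr_eq_pair_dist[OF a d m x(2,3)]
    by (rule mult_right_mono) (simp add: disc_bound_pos a d m less_imp_le)
  then show ?thesis
    using d by (simp add: mult.commute)
qed

text \<open>Equality here is equality in \<open>pair_dist_le\<close>, so the Cayley transforms of
  the roots have a common d-th power \<open>c\<close>; the condition on |1 - c| expresses |f(ai)| =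
  m. Conversely, the roots of such a polynomial are simple and attain Fekete's bound.\<close>

lemma discr_eq_disc_bound_iff:
  assumes a: "a > 0" and d: "d > 0" and m: "m > 0" and f: "admissible a d m f"
  shows "discr f = disc_bound a d m \<longleftrightarrow>
    (\<exists>c. cmod c = 1 \<and> cmod (1 - c) = (2 * a) ^ d / m \<and>
      map_poly complex_of_real f = circ_poly a d c)"
proof
  from f obtain x where x: "f = (\<Prod>j<d. [:- x j, 1:])"
    "discr f = (\<Prod>j<d. \<Prod>k\<in>{j<..<d}. (x j - x k)\<^sup>2)"
    "m = (\<Prod>j<d. cmod (of_real (x j) + of_real a * \<i>))"
    by (rule admissible_roots)
  have "discr f * real d ^ d = pair_dist {..<d} (\<lambda>j. cayley a (x j)) * disc_bound a d m"
    by (rule discr_eq_pair_dist[OF a d m x(2,3)])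
  then have iff: "discr f = disc_bound a d m \<longleftrightarrow>
      pair_dist {..<d} (\<lambda>j. cayley a (x j)) = real d ^ d"
    using disc_bound_pos[OF a d m] d by (auto simp: mult.commute)
  {
    assume "discr f = disc_bound a d m"
    then have "inj_on (\<lambda>j. cayley a (x j)) {..<d} \<and> (\<exists>c. \<forall>j\<in>{..<d}. cayley a (x j) ^ d = c)"
      using pair_dist_le(2)[of "{..<d}" "\<lambda>j. cayley a (x j)"] a d by (auto simp: iff cmod_cayley)
    then obtain c where inj: "inj_on x {..<d}" and c: "\<And>j. j < d \<Longrightarrow> cayley a (x j) ^ d = c"
      by (auto simp: inj_on_def)
    note c1 = cayley_power_eq_imp_circ_poly[OF a d x(1) inj c]
    have cm: "cmod c = 1"
      using c[of 0] d a cmod_cayley[of a "x 0"] by (auto simp: norm_power)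
    have "m = cmod (poly (circ_poly a d c) (complex_of_real a * \<i>))"
      using f by (simp add: admissible_def c1(2))
    also have "\<dots> = (2 * a) ^ d / cmod (1 - c)"
      using a d cm by (simp add: poly_circ_poly norm_divide norm_mult norm_power power_0_left flip: mult_2)
    finally have "cmod (1 - c) = (2 * a) ^ d / m"
      using m c1(1) by (simp add: field_simps)
    with cm c1 show "\<exists>c. cmod c = 1 \<and> cmod (1 - c) = (2 * a) ^ d / m \<and>
        map_poly complex_of_real f = circ_poly a d c"
      by blast
  }
  {
    assume "\<exists>c. cmod c = 1 \<and> cmod (1 - c) = (2 * a) ^ d / m \<and>
      map_poly complex_of_real f = circ_poly a d c"
    then obtain c where c: "cmod c = 1" "cmod (1 - c) = (2 * a) ^ d / m"
      "map_poly complex_of_real f = circ_poly a d c" by blast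
    have c1: "c \<noteq> 0" "c \<noteq> 1" using c a m by auto
    define y where "y j = complex_of_real (x j)" for j
    have circ: "circ_poly a d c = (\<Prod>j<d. [:- y j, 1:])"
      by (simp add: x(1) map_poly_of_real_prod_linear y_def flip: c(3))
    have root: "poly (circ_poly a d c) (y j) = 0" if "j < d" for j
      using that by (auto simp: circ poly_prod)
    \<comment> \<open>Coinciding roots would make the derivative vanish at a root, against the
      simplicity of the roots of \<open>circ_poly\<close>.\<close>
    have inj: "inj_on x {..<d}"
    proof (rule inj_onI)
      fix j k assume jk: "j \<in> {..<d}" "k \<in> {..<d}" "x j = x k"
      have "poly (pderiv (circ_poly a d c)) (y j) \<noteq> 0"
        by (rule poly_pderiv_circ_poly_nonzero) (use a c1 d root jk in auto)
      then have "(\<Prod>i\<in>{..<d} - {j}. y j - y i) \<noteq> 0"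
        using poly_pderiv_prod_linear[of "{..<d}" j y] jk by (simp add: circ)
      then show "j = k"
        using jk by (auto simp: y_def)
    qed
    have "cayley a (x j) ^ d = c" if "j < d" for j
      using root[OF that] circ_poly_root_cayley[of a c d "x j"] a c1 by (simp add: y_def)
    moreover have "inj_on (\<lambda>j. cayley a (x j)) {..<d}"
      using inj inj_cayley[of a] a by (auto simp: inj_on_def inj_def)
    ultimately show "discr f = disc_bound a d m"
      using pair_dist_eq_of_power_eq[of "{..<d}" "\<lambda>j. cayley a (x j)" c] a
      by (simp add: iff cmod_cayley)
  }
qed

theorem theorem4:
  fixes a m :: real and d :: nat
  assumes "a > 0" and "d \<ge> 2" and "m > a ^ d"
  shows "(\<forall>f. admissible a d m f \<longrightarrow> discr f \<le> disc_bound a d m) \<and>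
    (m \<ge> 2 ^ (d - 1) * a ^ d \<longrightarrow>
      (let D = disc_bound a d m;
           F = extremal_poly a d (extremal_B a d D);
           \<gamma> = extremal_angle d (extremal_p a d D)
       in (\<forall>f. admissible a d m f \<longrightarrow>
             (discr f = D \<longleftrightarrow>
               map_poly complex_of_real f = F \<or>
               map_poly complex_of_real f = smult ((-1) ^ d) (F \<circ>\<^sub>p [:0, -1:]))) \<and>
          proots F =
            image_mset (\<lambda>k. complex_of_real (a * tan (\<gamma> + real k * pi / real d)))
              (mset_set {0..<d})))"
proof (intro conjI impI)
  have m: "m > 0"
    using assms(1,3) by (metis less_trans zero_less_power)
  have d: "d > 0" using assms(2) by simp
  show "\<forall>f. admissible a d m f \<longrightarrow> discr f \<le> disc_bound a d m"
    using discr_le_disc_bound[OF assms(1) d m] by blast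
  assume m2: "m \<ge> 2 ^ (d - 1) * a ^ d"
  define D where "D = disc_bound a d m"
  define F where "F = extremal_poly a d (extremal_B a d D)"
  define p where "p = extremal_p a d D"
  define t where "t = (-1) ^ d * sqrt (1 / p\<^sup>2 - 1)"
  define c where "c = - (1 - of_real t * \<i>) / (1 + of_real t * \<i>)"
  have D0: "D > 0"
    using disc_bound_pos assms(1) d m by (simp add: D_def)
  have p: "p = 2 ^ (d - 1) * a ^ d / m"
    unfolding p_def D_def by (rule extremal_p_disc_bound[OF assms(1,2) m])
  \<comment> \<open>The assumption m >= 2^(d - 1) a^d is precisely p <= 1, which puts
    \<open>p\<close> in the domain of the inverse trigonometric functions and makes the radicand
    nonnegative.\<close>
  have p01: "0 < p" "p \<le> 1"
    using assms(1) m m2 by (simp_all add: p)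
  have p2: "(2 * a) ^ d / m = 2 * p"
    using d by (cases d) (simp_all add: p power_mult_distrib)
  have F: "F = circ_poly a d c"
    unfolding F_def extremal_B_eq[OF assms(1,2) D0] c_def t_def p_def
    by (rule extremal_poly_eq_circ_poly[OF assms(1) d])
  \<comment> \<open>Both 1 + it and 1 - it have modulus 1 / p; hence |c| = 1 and |1 - c| = 2 p, as
    the equality case requires.\<close>
  have t: "1 + t\<^sup>2 = 1 / p\<^sup>2"
    using p01 by (simp add: t_def power_mult_distrib power_le_one flip: power_mult)
  have t1: "1 + of_real t * \<i> \<noteq> 0" by (simp add: complex_eq_iff)
  have tp: "cmod (1 + of_real t * \<i>) = 1 / p"
    using p01 t by (simp add: cmod_def real_sqrt_divide)
  have tm: "cmod (1 - of_real t * \<i>) = 1 / p"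
    using p01 t by (simp add: cmod_def real_sqrt_divide)
  have cm: "cmod c = 1"
    unfolding c_def norm_divide norm_minus_cancel tp tm using p01 by simp
  have "1 - c = 2 / (1 + of_real t * \<i>)"
    using t1 by (simp add: c_def divide_simps)
  then have c2: "cmod (1 - c) = 2 * p"
    by (simp only: norm_divide tp) simp
  have c1: "c \<noteq> 0" "c \<noteq> 1" using cm c2 p01 by auto
  \<comment> \<open>Inversion is conjugation on the unit circle, so the reflected polynomial belongs
    to \<open>cnj c\<close>.\<close>
  have cnj: "cnj c = 1 / c"
    using cm c1 by (simp add: eq_divide_eq mult.commute complex_norm_square[symmetric])
  have G: "smult ((-1) ^ d) (F \<circ>\<^sub>p [:0, -1:]) = circ_poly a d (cnj c)"
    unfolding F cnj by (rule reflect_circ_poly[OF c1])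
  have c3: "cmod (cnj c) = 1" "cmod (1 - cnj c) = 2 * p"
    using cm c2 by (simp, metis complex_cnj_diff complex_cnj_one complex_mod_cnj)
  have "discr f = D \<longleftrightarrow> map_poly complex_of_real f = F \<or>
      map_poly complex_of_real f = smult ((-1) ^ d) (F \<circ>\<^sub>p [:0, -1:])"
    if f: "admissible a d m f" for f
  proof -
    \<comment> \<open>The parameters allowed by the equality case are exactly \<open>c\<close> and
      its conjugate, that is, \<open>F\<close> and its reflection.\<close>
    have eqv: "b = c \<or> b = cnj c \<longleftrightarrow> cmod b = 1 \<and> cmod (1 - b) = 2 * p" for b
      using cm c2 c3 unit_eq_or_cnj[of b c] by auto
    then show ?thesis
      unfolding G D_def discr_eq_disc_bound_iff[OF assms(1) d m f] p2
      by (simp only: F conj_assoc[symmetric] eqv[symmetric]) blast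
  qed
  moreover have "proots F = image_mset (\<lambda>k. complex_of_real
      (a * tan (extremal_angle d p + real k * pi / real d))) (mset_set {0..<d})"
    unfolding F
    by (rule proots_circ_poly_tan[OF assms(1) d _ c1(2)])
      (unfold c_def t_def, rule cis_extremal_angle[OF p01 d])
  ultimately show "let D = disc_bound a d m;
           F = extremal_poly a d (extremal_B a d D);
           \<gamma> = extremal_angle d (extremal_p a d D)
       in (\<forall>f. admissible a d m f \<longrightarrow>
             (discr f = D \<longleftrightarrow>
               map_poly complex_of_real f = F \<or>
               map_poly complex_of_real f = smult ((-1) ^ d) (F \<circ>\<^sub>p [:0, -1:]))) \<and>
          proots F =
            image_mset (\<lambda>k. complex_of_real (a * tan (\<gamma> + real k * pi / real d)))
              (mset_set {0..<d})"
    by (simp only: Let_def D_def[symmetric] F_def[symmetric] p_def[symmetric]) blast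
qed

end
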